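(* Let $G$ be an infinite group and let $\varkappa = |G|$ be its cardinality. Then $G$ can be partitioned into $\varkappa$ left $\aleph_1$-large subsets; that is, there exists a family of exactly $\varkappa$ pairwise disjoint subsets of $G$ whose union is $G$, each of which is left $\aleph_1$-large.
   Context: For a cardinal $\lambda$, a subset $A$ of a group $G$ is called left $\lambda$-large if there exists a subset $F \subseteq G$ with $|F| < \lambda$ such that $G = FA$, where $FA = \{fa : f \in F,\ a \in A\}$. In particular, $A$ is left $\aleph_1$-large if $G = FA$ for some countable (finite or countably infinite) $F \subseteq G$. *)

theory Defs
  imports "HOL-Algebra.Coset" "HOL-Library.Disjoint_Sets" "HOL-Library.Countable_Set"
begin

unbundle cardinal_syntax

text \<open>
  A cardinal is given by a cardinal order \<open>\<kappa>\<close>, possibly on a type other than that of the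
  group elements; \<open><o\<close> and \<open>=o\<close> compare cardinals across types.
\<close>

definition left_large :: "('a, 'm) monoid_scheme \<Rightarrow> 'c rel \<Rightarrow> 'a set \<Rightarrow> bool"
  where "left_large G \<kappa> A \<longleftrightarrow>
    A \<subseteq> carrier G \<and> (\<exists>F. F \<subseteq> carrier G \<and> |F| <o \<kappa> \<and> carrier G = F <#>\<^bsub>G\<^esub> A)"

definition aleph1 :: "nat set rel"
  where "aleph1 = cardSuc natLeq"

lemma card_of_ordLess_aleph1_iff: "|F| <o aleph1 \<longleftrightarrow> countable F"
proof -
  have "|F| <o aleph1 \<longleftrightarrow> |F| \<le>o natLeq"
    unfolding aleph1_def by (rule cardSuc_ordLeq_ordLess[OF natLeq_Card_order card_of_Card_order])
  also have "\<dots> \<longleftrightarrow> |F| \<le>o |UNIV :: nat set|"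
    using card_of_nat ordIso_symmetric ordLeq_ordIso_trans by blast
  also have "\<dots> \<longleftrightarrow> countable F"
    by (simp add: card_of_ordLeq[symmetric] countable_def)
  finally show ?thesis .
qed

end

theory Submission
  imports Defs "HOL-Algebra.Generated_Groups"
begin

text \<open>
  If \<open>G\<close> is countable, the singletons will do. Let \<open>G\<close> be uncountable and let \<open>H\<close> be a countably
  infinite subgroup. An element \<open>g\<close> can be given any colour from a finite palette \<open>S g\<close> by
  moving it along its coset \<open>H g\<close>: if \<open>S\<close> is constant on right cosets of \<open>H\<close>, colour each coset so
  that all colours of its palette occur. A colour \<open>c\<close> then has a large colour class as soon as
  countably many left translations suffice to bring every \<open>g\<close> to a place where \<open>c\<close> is in the
  palette (lemma \<open>large_partition_of_palettes\<close>).

  So \<open>|G|\<close> many colours with finite palettes are needed. Well-order \<open>G\<close>, and for \<open>c\<close> in \<open>G\<close> let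
  \<open>U c\<close> be the subgroup generated by \<open>H\<close> and all elements before \<open>c\<close>, and \<open>V c\<close> the one that is
  generated by \<open>H\<close> and all elements up to \<open>c\<close>. The colours are those \<open>c\<close> that are not in \<open>U c\<close>;
  together with \<open>H\<close> they generate \<open>G\<close>, so there are \<open>|G|\<close> of them. Put \<open>c\<close> into the palette
  of \<open>g\<close> when the coset \<open>U c g\<close> has a later minimum than the larger coset \<open>V c g\<close>.
  \<^item> Palettes are finite: along the colours in the palette of \<open>g\<close> the minima of \<open>V c g\<close> strictly decrease,
    and a strictly decreasing map between well-orders has a finite domain.
  \<^item> One of \<open>g\<close> and \<open>c g\<close> has \<open>c\<close> in its palette: \<open>U c g\<close> and \<open>U c (c g)\<close> are disjoint subsets
    of the same coset of \<open>V c\<close>, and the minimum of that coset lies in at most one of them.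
\<close>

section \<open>Order and cardinality\<close>

text \<open>
  By antitonicity every nonempty subset of the domain has a greatest element, namely the one with
  the least image; but a well-order whose converse is also well-founded is finite.
\<close>

lemma finite_if_strict_antitone_between_well_orders:
  assumes r: "Well_order r" and S: "S \<subseteq> Field r"
    and s: "Well_order s" and fS: "f ` S \<subseteq> Field s"
    and anti: "\<And>a b. a \<in> S \<Longrightarrow> b \<in> S \<Longrightarrow> (a, b) \<in> r \<Longrightarrow> a \<noteq> b \<Longrightarrow> (f b, f a) \<in> s \<and> f b \<noteq> f a"
  shows "finite S"
proof -
  interpret r: wo_rel r using r by (simp add: wo_rel_def)
  interpret s: wo_rel s using s by (simp add: wo_rel_def)
  have greatest: "\<exists>d\<in>T. \<forall>b\<in>T. (b, d) \<in> r" if T: "T \<subseteq> S" "T \<noteq> {}" for T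
  proof -
    have "s.minim (f ` T) \<in> f ` T" using T fS by (intro s.minim_in) auto
    then obtain d where d: "d \<in> T" "s.minim (f ` T) = f d" by auto
    have "(b, d) \<in> r" if "b \<in> T" for b
    proof (rule ccontr)
      assume nr: "(b, d) \<notin> r"
      have "b \<in> S" "d \<in> S" using that d(1) T(1) by auto
      moreover have "b \<noteq> d" using nr \<open>d \<in> S\<close> S r.REFL by (auto simp: refl_on_def)
      moreover have "(d, b) \<in> r" using nr \<open>b \<in> S\<close> \<open>d \<in> S\<close> S r.TOTALS by blast
      ultimately have "(f b, f d) \<in> s" "f b \<noteq> f d" using anti by auto
      moreover have "(f d, f b) \<in> s"
        using s.minim_least[of "f ` T" "f b"] that T(1) fS d(2) by auto
      ultimately show False using s.ANTISYM by (auto dest: antisymD)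
    qed
    then show ?thesis using d(1) by blast
  qed
  have below: "finite {b\<in>S. (b, x) \<in> r}" for x
  proof (induction x rule: wf_induct_rule[OF r.WF])
    case (1 x)
    let ?T = "{b\<in>S. (b, x) \<in> r - Id}"
    show ?case
    proof (cases "?T = {}")
      case True
      then have "{b\<in>S. (b, x) \<in> r} \<subseteq> {x}" by auto
      then show ?thesis by (rule finite_subset) simp
    next
      case False
      have "?T \<subseteq> S" by auto
      from greatest[OF this False] obtain d
        where d: "d \<in> ?T" "\<forall>b\<in>?T. (b, d) \<in> r" by blast
      have "{b\<in>S. (b, x) \<in> r} \<subseteq> insert x {b\<in>S. (b, d) \<in> r}" using d(2) by auto
      moreover have "finite {b\<in>S. (b, d) \<in> r}" using 1 d(1) by auto
      ultimately show ?thesis by (meson finite_insert finite_subset)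
    qed
  qed
  show ?thesis
  proof (cases "S = {}")
    case False
    then obtain d where "d \<in> S" "\<forall>b\<in>S. (b, d) \<in> r" using greatest by blast
    then have "S \<subseteq> {b\<in>S. (b, d) \<in> r}" by blast
    then show ?thesis using below finite_subset by blast
  qed simp
qed

lemma card_of_ordLeq_infinite_if_finite:
  assumes "finite S" "infinite K"
  shows "|S| \<le>o |K|"
  using assms by (metis card_of_Well_order card_of_ordLeq_finite ordLeq_total)

text \<open>
  Closing \<open>X\<close>, its inverses and \<open>\<one>\<close> under products takes \<open>\<omega>\<close> steps, none of which changes an
  infinite cardinality.
\<close>

lemma card_of_generate_ordLeq:
  fixes G (structure)
  assumes inf: "infinite X"
  shows "|generate G X| \<le>o |X|"
proof -
  define step where "step = (\<lambda>Y. Y \<union> (\<lambda>(x, y). x \<otimes> y) ` (Y \<times> Y))"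
  define Y where "Y n = (step ^^ n) (X \<union> m_inv G ` X \<union> {\<one>})" for n :: nat
  have Un_le: "|A \<union> B| \<le>o |X|" if "|A| \<le>o |X|" "|B| \<le>o |X|" for A B :: "'a set"
    using that inf
    by (intro card_of_Un_ordLeq_infinite_Field[OF _ _ _ card_of_Card_order]) (simp_all add: Field_card_of)
  have Y_le: "|Y n| \<le>o |X|" for n
  proof (induction n)
    case 0
    have "|{\<one>}| \<le>o |X|" using inf by (intro card_of_ordLeq_infinite_if_finite) auto
    then show ?case unfolding Y_def by (simp add: Un_le card_of_image card_of_refl ordIso_imp_ordLeq del: Un_insert_right)
  next
    case (Suc n)
    have "|Y n \<times> Y n| \<le>o |X|"
      using Suc inf
      by (intro card_of_Times_ordLeq_infinite_Field[OF _ _ _ card_of_Card_order])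
        (simp_all add: Field_card_of)
    then have "|(\<lambda>(x, y). x \<otimes> y) ` (Y n \<times> Y n)| \<le>o |X|"
      using card_of_image ordLeq_transitive by blast
    moreover have "Y (Suc n) = Y n \<union> (\<lambda>(x, y). x \<otimes> y) ` (Y n \<times> Y n)"
      by (simp add: Y_def step_def)
    ultimately show ?case using Suc Un_le by simp
  qed
  have Y_mono: "Y m \<subseteq> Y n" if "m \<le> n" for m n
    using that by (rule lift_Suc_mono_le[rotated]) (auto simp: Y_def step_def)
  have "x \<in> (\<Union>n. Y n)" if "x \<in> generate G X" for x
    using that
  proof induction
    case one
    have "\<one> \<in> Y 0" by (simp add: Y_def)
    then show ?case by blast
  next
    case (incl h)
    then have "h \<in> Y 0" by (simp add: Y_def)
    then show ?case by blast
  next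
    case (inv h)
    then have "inv h \<in> Y 0" by (simp add: Y_def)
    then show ?case by blast
  next
    case (eng x y)
    then obtain m n where "x \<in> Y m" "y \<in> Y n" by blast
    then have "x \<in> Y (max m n)" "y \<in> Y (max m n)" using Y_mono by (meson max.cobounded1 max.cobounded2 subsetD)+
    then have "x \<otimes> y \<in> Y (Suc (max m n))" by (force simp: Y_def step_def)
    then show ?case by blast
  qed
  then have "|generate G X| \<le>o |\<Union>n. Y n|" by (simp add: card_of_mono1 subsetI)
  also have "|\<Union>n. Y n| \<le>o |X|"
    using inf Y_le by (intro card_of_UNION_ordLeq_infinite) (auto simp: infinite_iff_card_of_nat)
  finally show ?thesis .
qed

lemma ex_surjection_from_infinite_onto_finite:
  assumes "finite S" "infinite K"
  shows "\<exists>q. S \<subseteq> q ` K"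
proof -
  have "|S| \<le>o |K|" using assms by (rule card_of_ordLeq_infinite_if_finite)
  then obtain f where f: "inj_on f S" "f ` S \<subseteq> K" unfolding card_of_ordLeq[symmetric] by blast
  have "inv_into S f ` f ` S = S" using inv_into_image_cancel[OF f(1) subset_refl] .
  then have "S \<subseteq> inv_into S f ` K" using f(2) by (metis image_mono)
  then show ?thesis by blast
qed

context group
begin

lemma ex_countably_infinite_subgroup:
  assumes "infinite (carrier G)"
  shows "\<exists>H. subgroup H G \<and> countable H \<and> infinite H"
proof -
  obtain X where X: "X \<subseteq> carrier G" "infinite X" "countable X"
    using assms infinite_countable_subset' by blast
  have "countable (generate G X)"
    using card_of_generate_ordLeq[OF X(2), of G] X(3)
    by (meson card_of_ordLess_aleph1_iff ordLeq_ordLess_trans)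
  moreover have "infinite (generate G X)"
    using X(2) by (meson finite_subset generate.incl subsetI)
  ultimately show ?thesis using generate_is_subgroup[OF X(1)] by blast
qed

section \<open>From palettes to partitions\<close>

lemma left_large_aleph1I:
  assumes A: "A \<subseteq> carrier G" and K: "K \<subseteq> carrier G" "countable K"
    and hit: "\<And>g. g \<in> carrier G \<Longrightarrow> \<exists>k\<in>K. k \<otimes> g \<in> A"
  shows "left_large G aleph1 A"
proof -
  let ?F = "m_inv G ` K"
  have "g \<in> ?F <#> A" if g: "g \<in> carrier G" for g
  proof -
    obtain k where k: "k \<in> K" "k \<otimes> g \<in> A" using hit g by blast
    then have "g = inv k \<otimes> (k \<otimes> g)" using g K(1) by (simp add: m_assoc[symmetric] subsetD)
    then show ?thesis using k unfolding set_mult_def by blast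
  qed
  moreover have "?F <#> A \<subseteq> carrier G" using A K(1) by (auto simp: set_mult_def subset_iff)
  ultimately have "carrier G = ?F <#> A" by blast
  moreover have "|?F| <o aleph1" using K(2) by (simp add: card_of_ordLess_aleph1_iff)
  moreover have "?F \<subseteq> carrier G" using K(1) by auto
  ultimately show ?thesis unfolding left_large_def using A by blast
qed

text \<open>
  The colouring is chosen separately on each coset \<open>H #> g\<close>, which is infinite, so that all colours
  of the common palette of its elements occur. To meet colour \<open>c\<close> from \<open>g\<close>, move first by an
  element of \<open>K c\<close> to a coset whose palette has \<open>c\<close> and then inside that coset by an element of
  \<open>H\<close>; altogether the countable set \<open>H <#> K c\<close> of translations is enough.
\<close>

lemma large_partition_of_palettes:
  assumes H: "subgroup H G" "countable H" "infinite H"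
    and C: "C \<noteq> {}"
    and fin: "\<And>g. g \<in> carrier G \<Longrightarrow> finite (S g)"
    and coset: "\<And>h g. h \<in> H \<Longrightarrow> g \<in> carrier G \<Longrightarrow> S (h \<otimes> g) = S g"
    and K: "\<And>c. c \<in> C \<Longrightarrow> K c \<subseteq> carrier G" "\<And>c. c \<in> C \<Longrightarrow> countable (K c)"
    and reach: "\<And>c g. c \<in> C \<Longrightarrow> g \<in> carrier G \<Longrightarrow> \<exists>k\<in>K c. c \<in> S (k \<otimes> g)"
  shows "\<exists>P. partition_on (carrier G) P \<and> |P| =o |C| \<and> (\<forall>A\<in>P. left_large G aleph1 A)"
proof -
  note Hc = subgroup.mem_carrier[OF H(1)]
  have inf_coset: "infinite (H #> g)" if "g \<in> carrier G" for g
  proof -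
    have "inj_on (\<lambda>h. h \<otimes> g) H" using that Hc by (auto intro!: inj_onI)
    moreover have "(\<lambda>h. h \<otimes> g) ` H = H #> g" by (auto simp: r_coset_def)
    ultimately show ?thesis using H(3) finite_image_iff by metis
  qed
  have "\<exists>q. \<forall>g\<in>carrier G. H #> g = B \<longrightarrow> S g \<subseteq> q ` B" for B
  proof (cases "\<exists>g0\<in>carrier G. H #> g0 = B")
    case True
    then obtain g0 where g0: "g0 \<in> carrier G" "H #> g0 = B" by blast
    obtain q where q: "S g0 \<subseteq> q ` B"
      using ex_surjection_from_infinite_onto_finite[OF fin inf_coset] g0 by blast
    have "S g = S g0" if g: "g \<in> carrier G" "H #> g = B" for g
    proof -
      have "g \<in> H #> g0" using rcos_self[OF g(1) H(1)] g(2) g0(2) by simp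
      then obtain h where "h \<in> H" "g = h \<otimes> g0" by (auto simp: r_coset_def)
      then show ?thesis using coset g0(1) by simp
    qed
    then show ?thesis using q by blast
  qed blast
  then obtain q where q: "\<And>g. g \<in> carrier G \<Longrightarrow> S g \<subseteq> q (H #> g) ` (H #> g)" by metis
  obtain c0 where c0: "c0 \<in> C" using C by blast
  \<comment> \<open>\<open>c0\<close> absorbs the elements to which \<open>q\<close> gives no value in \<open>C\<close>, so that the classes cover \<open>G\<close>.\<close>
  define col where "col g = (if q (H #> g) g \<in> C then q (H #> g) g else c0)" for g
  define A where "A c = {g\<in>carrier G. col g = c}" for c
  have col_C: "col g \<in> C" for g using c0 by (simp add: col_def)
  have hit: "\<exists>k\<in>H <#> K c. k \<otimes> g \<in> A c" if c: "c \<in> C" and g: "g \<in> carrier G" for c g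
  proof -
    obtain k where k: "k \<in> K c" "c \<in> S (k \<otimes> g)" using reach c g by blast
    have kc: "k \<in> carrier G" using k(1) K(1)[OF c] by blast
    obtain x where x: "x \<in> H #> (k \<otimes> g)" "c = q (H #> (k \<otimes> g)) x"
      using q[of "k \<otimes> g"] k(2) kc g by auto
    have same: "H #> x = H #> (k \<otimes> g)" using repr_independence[OF x(1) _ H(1)] kc g by simp
    obtain h where h: "h \<in> H" "x = h \<otimes> (k \<otimes> g)" using x(1) by (auto simp: r_coset_def)
    have "(h \<otimes> k) \<otimes> g = x" using h kc g Hc by (simp add: m_assoc)
    moreover have "col x = c" using same x(2) c by (simp add: col_def)
    moreover have "x \<in> carrier G" using h kc g Hc by simp
    moreover have "h \<otimes> k \<in> H <#> K c" using h(1) k(1) by (auto simp: set_mult_def)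
    ultimately show ?thesis unfolding A_def by blast
  qed
  have large: "left_large G aleph1 (A c)" if c: "c \<in> C" for c
  proof (rule left_large_aleph1I)
    show "A c \<subseteq> carrier G" by (auto simp: A_def)
    show "H <#> K c \<subseteq> carrier G" using Hc K(1)[OF c] by (auto simp: set_mult_def)
    have "H <#> K c = (\<lambda>(h, k). h \<otimes> k) ` (H \<times> K c)" by (auto simp: set_mult_def)
    then show "countable (H <#> K c)" using H(2) K(2)[OF c] by simp
  qed (use hit c in blast)
  have nonempty: "A c \<noteq> {}" if "c \<in> C" for c using hit[OF that one_closed] by blast
  have "partition_on (carrier G) (A ` C)"
  proof (rule partition_onI)
    show "\<Union>(A ` C) = carrier G" using col_C by (auto simp: A_def)
    show "disjnt X Y" if "X \<in> A ` C" "Y \<in> A ` C" "X \<noteq> Y" for X Y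
      using that by (auto simp: A_def disjnt_def)
  qed (use nonempty in blast)
  moreover have "inj_on A C" using nonempty by (force simp: A_def inj_on_def)
  then have "|A ` C| =o |C|"
    using card_of_ordIso inj_on_imp_bij_betw ordIso_symmetric by blast
  ultimately show ?thesis using large by blast
qed

section \<open>Palettes from coset minima\<close>

text \<open>
  \<open>C\<close> is found by discarding from a well-order of \<open>G\<close> every element that is generated by \<open>H\<close> and
  earlier elements. \<open>H\<close> and \<open>C\<close> still generate \<open>G\<close>, so \<open>C\<close> is uncountable and of size \<open>|G|\<close>.
\<close>

lemma card_of_non_redundant_elements:
  assumes H: "subgroup H G" "countable H" "infinite H" and unc: "uncountable (carrier G)"
    and r: "well_order_on (carrier G) r"
    and C: "C = {c\<in>carrier G. c \<notin> generate G (H \<union> {b. (b, c) \<in> r - Id})}"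
  shows "|C| =o |carrier G|"
proof -
  have sub: "H \<union> C \<subseteq> carrier G" using C subgroup.subset[OF H(1)] by blast
  have wf: "wf (r - Id)" using r by (simp add: well_order_on_def)
  have gen: "x \<in> carrier G \<longrightarrow> x \<in> generate G (H \<union> C)" for x
  proof (induction x rule: wf_induct_rule[OF wf])
    case (1 x)
    have "x \<in> generate G (H \<union> C)" if x: "x \<in> carrier G" "x \<notin> C"
    proof -
      have "{b. (b, x) \<in> r - Id} \<subseteq> generate G (H \<union> C)"
        using 1 well_order_on_domain[OF r] by blast
      then have "H \<union> {b. (b, x) \<in> r - Id} \<subseteq> generate G (H \<union> C)" by (auto intro: generate.incl)
      then have "generate G (H \<union> {b. (b, x) \<in> r - Id}) \<subseteq> generate G (H \<union> C)"
        using generate_subgroup_incl generate_is_subgroup[OF sub] by blast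
      then show ?thesis using x C by blast
    qed
    then show ?case by (auto intro: generate.incl)
  qed
  have "|carrier G| \<le>o |generate G (H \<union> C)|" using gen by (simp add: card_of_mono1 subsetI)
  also have "|generate G (H \<union> C)| \<le>o |H \<union> C|" using H(3) by (simp add: card_of_generate_ordLeq)
  finally have le: "|carrier G| \<le>o |H \<union> C|" .
  have "uncountable C"
  proof
    assume "countable C"
    then have "|H \<union> C| <o aleph1" using H(2) by (simp add: card_of_ordLess_aleph1_iff)
    then have "|carrier G| <o aleph1" using le ordLeq_ordLess_trans by blast
    then show False using unc by (simp add: card_of_ordLess_aleph1_iff)
  qed
  then have infC: "infinite C" using countable_finite by blast
  have "|H| \<le>o |C|"
    using H(2) infC by (meson card_of_ordLess_aleph1_iff \<open>uncountable C\<close> not_ordLess_ordLeq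
        ordLeq_total card_of_Well_order ordLeq_ordLess_trans)
  then have "|H \<union> C| \<le>o |C|"
    using infC by (intro card_of_Un_ordLeq_infinite_Field[OF _ _ _ card_of_Card_order])
      (simp_all add: Field_card_of card_of_refl ordIso_imp_ordLeq)
  then have "|carrier G| \<le>o |C|" using le ordLeq_transitive by blast
  moreover have "|C| \<le>o |carrier G|" using sub by (simp add: card_of_mono1)
  ultimately show ?thesis by (simp add: ordIso_iff_ordLeq)
qed

lemma ex_large_partition_of_uncountable:
  assumes unc: "uncountable (carrier G)"
  shows "\<exists>P. partition_on (carrier G) P \<and> |P| =o |carrier G| \<and> (\<forall>A\<in>P. left_large G aleph1 A)"
proof -
  obtain H where H: "subgroup H G" "countable H" "infinite H"
    using ex_countably_infinite_subgroup uncountable_infinite[OF unc] by metis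
  obtain r where r: "well_order_on (carrier G) r" using well_order_on[of "carrier G"] ..
  have Fr: "Field r = carrier G" using well_order_on_Field[OF r] by simp
  have Wr: "Well_order r" using r Fr by simp
  interpret r: wo_rel r using Wr by (simp add: wo_rel_def)
  define U where "U c = generate G (H \<union> {b. (b, c) \<in> r - Id})" for c
  define V where "V c = generate G (H \<union> {b. (b, c) \<in> r})" for c
  define C where "C = {c\<in>carrier G. c \<notin> U c}"
  define S where "S g = {c\<in>C. r.minim (V c #> g) \<noteq> r.minim (U c #> g)}" for g
  have C_carrier: "c \<in> carrier G" if "c \<in> C" for c using that by (simp add: C_def)
  have cardC: "|C| =o |carrier G|"
    using card_of_non_redundant_elements[OF H unc r] by (simp add: C_def U_def)
  have sub: "H \<union> {b. (b, c) \<in> r - Id} \<subseteq> carrier G" "H \<union> {b. (b, c) \<in> r} \<subseteq> carrier G" for c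
    using subgroup.subset[OF H(1)] well_order_on_domain[OF r] by blast+
  have U: "subgroup (U c) G" and V: "subgroup (V c) G" for c
    unfolding U_def V_def by (rule generate_is_subgroup[OF sub(1)], rule generate_is_subgroup[OF sub(2)])
  have HU: "H \<subseteq> U c" for c unfolding U_def by (auto intro: generate.incl)
  have UV: "U c \<subseteq> V c" for c unfolding U_def V_def by (intro mono_generate) auto
  have cV: "c \<in> V c" if "c \<in> C" for c
    unfolding V_def using C_carrier[OF that] Fr r.REFL by (auto intro!: generate.incl simp: refl_on_def)
  have VU: "V a \<subseteq> U b" if "(a, b) \<in> r" "a \<noteq> b" for a b
    unfolding U_def V_def
  proof (rule mono_generate)
    have "(x, b) \<in> r - Id" if "(x, a) \<in> r" for x
      using transD[OF r.TRANS that \<open>(a, b) \<in> r\<close>] antisymD[OF r.ANTISYM that] \<open>(a, b) \<in> r\<close> \<open>a \<noteq> b\<close>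
      by blast
    then show "H \<union> {x. (x, a) \<in> r} \<subseteq> H \<union> {x. (x, b) \<in> r - Id}" by blast
  qed
  have coset_Field: "W #> g \<subseteq> Field r" if "subgroup W G" "g \<in> carrier G" for W g
    using that Fr by (simp add: r_coset_subset_G subgroup.subset)
  have coset_min: "r.minim (W #> g) \<in> W #> g" if "subgroup W G" "g \<in> carrier G" for W g
    using rcos_self[OF that(2,1)] coset_Field[OF that] by (intro r.minim_in) auto
  have coset_min_le: "(r.minim (W' #> g), r.minim (W #> g)) \<in> r"
    if "subgroup W G" "subgroup W' G" "W \<subseteq> W'" "g \<in> carrier G" for W W' g
    using coset_min[OF that(1,4)] coset_Field[OF that(2,4)] that(3)
    by (intro r.minim_least) (auto simp: r_coset_def)
  have coset_absorb: "W #> (w \<otimes> g) = W #> g"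
    if "subgroup W G" "w \<in> W" "g \<in> carrier G" for W w g
    using coset_mult_assoc[OF subgroup.subset[OF that(1)] subgroup.mem_carrier[OF that(1,2)] that(3)]
      coset_join2[OF subgroup.mem_carrier[OF that(1,2)] that(1,2)] by simp
  have "finite (S g)" if g: "g \<in> carrier G" for g
  proof (rule finite_if_strict_antitone_between_well_orders[OF Wr _ Wr])
    show "S g \<subseteq> Field r" using C_carrier Fr by (auto simp: S_def)
    show "(\<lambda>c. r.minim (V c #> g)) ` S g \<subseteq> Field r"
      using coset_min[OF V g] coset_Field[OF V g] by blast
  next
    fix a b assume ab: "a \<in> S g" "b \<in> S g" "(a, b) \<in> r" "a \<noteq> b"
    \<comment> \<open>\<open>V a\<close> lies below \<open>U b\<close>, and the minimum drops between \<open>U b\<close> and \<open>V b\<close>.\<close>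
    have "(r.minim (U b #> g), r.minim (V a #> g)) \<in> r"
      using coset_min_le[OF V U VU g] ab by blast
    moreover have "(r.minim (V b #> g), r.minim (U b #> g)) \<in> r"
      using coset_min_le[OF U V UV g] .
    moreover have "r.minim (V b #> g) \<noteq> r.minim (U b #> g)" using ab(2) by (simp add: S_def)
    ultimately show "(r.minim (V b #> g), r.minim (V a #> g)) \<in> r
        \<and> r.minim (V b #> g) \<noteq> r.minim (V a #> g)"
      using r.TRANS r.ANTISYM by (metis antisymD transD)
  qed
  moreover have "S (h \<otimes> g) = S g" if "h \<in> H" "g \<in> carrier G" for h g
    using that HU UV by (simp add: S_def coset_absorb[OF U] coset_absorb[OF V] subset_iff)
  moreover have "\<exists>k\<in>{\<one>, c}. c \<in> S (k \<otimes> g)" if c: "c \<in> C" and g: "g \<in> carrier G" for c g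
  proof (rule ccontr)
    assume none: "\<not> ?thesis"
    have cc: "c \<in> carrier G" using C_carrier[OF c] .
    have "r.minim (V c #> g) = r.minim (U c #> g)"
      using none c g by (simp add: S_def)
    moreover have "r.minim (V c #> g) = r.minim (U c #> (c \<otimes> g))"
      using none c g coset_absorb[OF V cV[OF c] g] by (simp add: S_def)
    \<comment> \<open>The same minimum then lies in both cosets of \<open>U c\<close>, which must coincide.\<close>
    ultimately have "r.minim (V c #> g) \<in> U c #> g" "r.minim (V c #> g) \<in> U c #> (c \<otimes> g)"
      using coset_min[OF U] g cc by (metis m_closed)+
    then have "U c #> g = U c #> (c \<otimes> g)"
      using repr_independence[OF _ _ U] g cc by (metis m_closed)
    then have "c \<otimes> g \<in> U c #> g" using rcos_self[OF _ U] g cc by (metis m_closed)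
    then obtain u where "u \<in> U c" "c \<otimes> g = u \<otimes> g" by (auto simp: r_coset_def)
    then have "c \<in> U c" using g cc subgroup.mem_carrier[OF U] by (metis right_cancel)
    then show False using c by (simp add: C_def)
  qed
  moreover have "C \<noteq> {}" using cardC unc by (metis card_of_ordIso_finite countable_finite finite.emptyI)
  ultimately obtain P where "partition_on (carrier G) P" "|P| =o |C|"
    "\<forall>A\<in>P. left_large G aleph1 A"
    using large_partition_of_palettes[OF H, of C S "\<lambda>c. {\<one>, c}"] C_carrier by auto
  then show ?thesis using cardC ordIso_transitive by blast
qed

end

theorem theorem2p1:
  fixes G :: "('a, 'm) monoid_scheme" (structure)
  assumes "group G" and "infinite (carrier G)"
  shows "\<exists>P. partition_on (carrier G) P \<and> |P| =o |carrier G| \<and>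
    (\<forall>A\<in>P. left_large G aleph1 A)"
proof -
  interpret group G by fact
  show ?thesis
  proof (cases "countable (carrier G)")
    case True
    let ?P = "(\<lambda>x. {x}) ` carrier G"
    have "|?P| =o |carrier G|"
      by (intro ordIso_symmetric[OF card_of_ordIsoI[of "\<lambda>x. {x}"]]) (auto simp: bij_betw_def)
    moreover have "left_large G aleph1 {x}" if x: "x \<in> carrier G" for x
    proof (rule left_large_aleph1I[OF _ subset_refl True])
      fix g assume "g \<in> carrier G"
      then show "\<exists>k\<in>carrier G. k \<otimes> g \<in> {x}"
        using x by (intro bexI[of _ "x \<otimes> inv g"]) (auto simp: m_assoc)
    qed (use x in simp)
    ultimately show ?thesis using partition_on_singletons by blast
  next
    case False
    then show ?thesis by (rule ex_large_partition_of_uncountable)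
  qed
qed

end
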